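(* Let $p$ be an odd prime. Then (a) \[ \sum_{j=1}^{p-1}r_4(j) \left( \sigma^{\ast}(p-j)- 4\sigma^{\ast}\!\left(\tfrac{p-j}{2}\right) \right)= p^2 -1, \] (b) \[ \sum_{j=1}^{p-1}r_8(j) \left( \sigma^{\ast}(p-j)- 4\sigma^{\ast}\!\left(\tfrac{p-j}{2}\right) \right)= p^4 -1. \]
   Context: For $k\in\mathbb{N}$, $r_k(n)=\#\{(x_1,\dots,x_k)\in\mathbb{Z}^k : n=x_1^2+\dots+x_k^2\}$. The function $\sigma^{\ast}$ is defined on $\mathbb{Q}$ by $\sigma^{\ast}(q)=0$ if $q\notin\mathbb{N}=\{1,2,\dots\}$, and $\sigma^{\ast}(q)=\sum_{d\mid q,\ q/d\text{ odd}} d$ for $q\in\mathbb{N}$. *)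

theory Defs
  imports Complex_Main "HOL-Computational_Algebra.Primes"
begin

text \<open>Integer \<^term>\<open>k\<close>-tuples are represented by lists of length \<^term>\<open>k\<close>.\<close>

definition r :: "nat \<Rightarrow> nat \<Rightarrow> nat" where
  "r k n = card {xs :: int list. length xs = k \<and> (\<Sum>x\<leftarrow>xs. x ^ 2) = int n}"

text \<open>The counted set is finite, so \<^const>\<open>card\<close> is a genuine count.\<close>

lemma finite_representations:
  "finite {xs :: int list. length xs = k \<and> (\<Sum>x\<leftarrow>xs. x ^ 2) = int n}"
proof (rule finite_subset)
  show "{xs :: int list. length xs = k \<and> (\<Sum>x\<leftarrow>xs. x ^ 2) = int n}
      \<subseteq> {xs. set xs \<subseteq> {- int n..int n} \<and> length xs = k}"
  proof safe
    fix xs :: "int list" and x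
    assume eq: "(\<Sum>x\<leftarrow>xs. x ^ 2) = int n" and x: "x \<in> set xs"
    have "x ^ 2 \<le> (\<Sum>x\<leftarrow>xs. x ^ 2)"
      using x by (intro member_le_sum_list) auto
    moreover have "\<bar>x\<bar> \<le> x ^ 2"
    proof (cases "x = 0")
      case False
      then have "\<bar>x\<bar> * 1 \<le> \<bar>x\<bar> * \<bar>x\<bar>"
        by (intro mult_left_mono) auto
      then show ?thesis
        by (simp add: power2_eq_square)
    qed simp
    ultimately have "\<bar>x\<bar> \<le> int n"
      using eq by simp
    then show "x \<in> {- int n..int n}"
      by auto
  qed
  show "finite {xs. set xs \<subseteq> {- int n..int n} \<and> length xs = k}"
    by (rule finite_lists_length_eq) simp
qed

text \<open>
  The library's \<^term>\<open>\<nat> :: rat set\<close> contains \<^term>\<open>0 :: rat\<close>, which has to be excluded here.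
  For \<^term>\<open>q \<in> (\<nat> :: rat set)\<close>, \<^term>\<open>nat \<lfloor>q :: rat\<rfloor>\<close> is \<^term>\<open>q\<close> as a natural number.
\<close>

definition sigma_star :: "rat \<Rightarrow> int" where
  "sigma_star q =
     (if q \<in> \<nat> - {0} then \<Sum>d | d dvd nat \<lfloor>q\<rfloor> \<and> odd (nat \<lfloor>q\<rfloor> div d). int d else 0)"

lemma sigma_star_of_nat:
  "n > 0 \<Longrightarrow> sigma_star (of_nat n) = (\<Sum>d | d dvd n \<and> odd (n div d). int d)"
  by (simp add: sigma_star_def)

end

theory Submission
  imports Defs "HOL-Computational_Algebra.Formal_Power_Series"
begin

text \<open>
  Let theta be the generating function of the squares of integers and psi that of the triangular
  numbers. Gauss's product for psi gives the logarithmic derivative of psi under q d/dq, and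
  psi(q)^2 = theta(q) psi(q^2) turns it into that of theta, which is twice the generating function
  of sigma*(n) - 4 sigma*(n/2). Hence n r_k(n) is 2k times the convolution of r_k with this
  function, and for n = p both claims reduce to r_4(p) = 8 (p + 1) and r_8(p) = 16 (p^3 + 1).

  From theta(q)^2 = theta(q^2)^2 + 4 q psi(q^4)^2 one gets
  theta(q)^4 = theta(q^2)^4 + 16 q^2 psi(q^4)^4 + 8 q psi(q^2)^4, so r_4 is known once
  q psi(q^2)^4 is identified as the generating function of sigma(n) over odd n. The two series
  have the same logarithmic derivative by an elementary identity of Liouville, and another
  instance of the same identity evaluates the self-convolution of r_4 at odd arguments, which is r_8.
\<close>

unbundle fps_syntax

section \<open>Logarithmic derivatives of formal power series\<close>

definition qderiv :: "int fps \<Rightarrow> int fps" where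
  "qderiv f = fps_X * fps_deriv f"

lemma qderiv_nth: "qderiv f $ n = int n * f $ n"
  by (cases n) (auto simp: qderiv_def fps_eq_iff)

lemma qderiv_mult: "qderiv (f * g) = qderiv f * g + f * qderiv g"
  by (simp add: qderiv_def algebra_simps)

text \<open>Encodes l = q f'/f without a division, so that it also applies to series without
  constant term, such as \<open>fps_X\<close> with l = 1.\<close>

definition log_deriv :: "int fps \<Rightarrow> int fps \<Rightarrow> bool" where
  "log_deriv f l \<longleftrightarrow> qderiv f = f * l"

lemma log_deriv_mult: "log_deriv f l \<Longrightarrow> log_deriv g m \<Longrightarrow> log_deriv (f * g) (l + m)"
  by (simp add: log_deriv_def qderiv_mult algebra_simps)

lemma log_deriv_1: "log_deriv 1 0"
  by (simp add: log_deriv_def qderiv_def)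

lemma log_deriv_power: "log_deriv f l \<Longrightarrow> log_deriv (f ^ k) (of_nat k * l)"
proof (induction k)
  case (Suc k)
  then show ?case
    using log_deriv_mult[of f l "f ^ k" "of_nat k * l"] by (simp add: algebra_simps)
qed (simp add: log_deriv_1)

lemma log_deriv_cancel:
  assumes "f * g = h" and "log_deriv g m" and "log_deriv h l" and "g \<noteq> 0"
  shows "log_deriv f (l - m)"
proof -
  have "qderiv f * g + f * (g * m) = f * g * l"
    using assms(2,3) unfolding log_deriv_def assms(1)[symmetric] qderiv_mult by simp
  then have "g * (qderiv f - f * (l - m)) = 0"
    by (simp add: algebra_simps)
  with \<open>g \<noteq> 0\<close> show ?thesis
    by (simp add: log_deriv_def)
qed

lemma compose_square_nth:
  "(f oo fps_X ^ 2) $ n = (if even n then f $ (n div 2) else 0)" for f :: "int fps"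
proof -
  have "(f oo fps_X ^ 2) $ n = (\<Sum>i=0..n. if 2 * i = n then f $ i else 0)"
    unfolding fps_compose_nth power_mult[symmetric] by (intro sum.cong) (auto simp: mult.commute)
  also have "\<dots> = (if even n then f $ (n div 2) else 0)"
  proof (cases "even n")
    case True
    then obtain m where "n = 2 * m" by blast
    then show ?thesis by simp
  qed (auto intro!: sum.neutral)
  finally show ?thesis .
qed

text \<open>Chain rule: \<open>f oo fps_X ^ 2\<close> is f(q^2), and q d/dq picks up the factor 2
  from the exponent.\<close>

lemma log_deriv_compose_square:
  assumes "log_deriv f l"
  shows "log_deriv (f oo fps_X ^ 2) (2 * (l oo fps_X ^ 2))"
proof -
  have "qderiv (f oo fps_X ^ 2) = 2 * (qderiv f oo fps_X ^ 2)"
    by (rule fps_ext) (auto simp: qderiv_nth compose_square_nth fps_mult_nth_0 numeral_fps_const)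
  also have "\<dots> = (f oo fps_X ^ 2) * (2 * (l oo fps_X ^ 2))"
    using assms by (simp add: log_deriv_def fps_compose_mult_distrib)
  finally show ?thesis by (simp add: log_deriv_def)
qed

text \<open>Comparing coefficients gives (n - k) f_n = sum of f_i l_(n-i) over i < n, so every
  coefficient beyond k is determined by the earlier ones. At n = k this says nothing about f_k,
  hence the assumed agreement up to k inclusive.\<close>

lemma log_deriv_unique:
  assumes f: "log_deriv f (of_nat k + l)" and g: "log_deriv g (of_nat k + l)"
    and l: "l $ 0 = 0" and eq: "\<And>n. n \<le> k \<Longrightarrow> f $ n = g $ n"
  shows "f = g"
proof (rule fps_ext)
  fix n
  show "f $ n = g $ n"
  proof (induction n rule: less_induct)
    case (less n)
    show ?case
    proof (cases "n \<le> k")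
      case False
      have rec: "(int n - int k) * h $ n = (\<Sum>i<n. h $ i * l $ (n - i))"
        if "log_deriv h (of_nat k + l)" for h
      proof -
        have "qderiv h = of_nat k * h + h * l"
          using that by (simp add: log_deriv_def algebra_simps)
        from arg_cong[OF this, of "\<lambda>f. f $ n"]
        have "(int n - int k) * h $ n = (h * l) $ n"
          by (simp add: qderiv_nth fps_of_nat[symmetric] algebra_simps)
        also have "\<dots> = (\<Sum>i<n. h $ i * l $ (n - i))"
          using l by (simp add: fps_mult_nth atLeast0AtMost lessThan_Suc_atMost[symmetric])
        finally show ?thesis .
      qed
      have "(int n - int k) * f $ n = (int n - int k) * g $ n"
        unfolding rec[OF f] rec[OF g] using less by simp
      with False show ?thesis by simp
    qed (rule eq)
  qed
qed

section \<open>Gauss's product for the triangular numbers\<close>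

definition geom :: "nat \<Rightarrow> int fps" where
  "geom d = Abs_fps (\<lambda>n. if d dvd n then 1 else 0)"

lemma geom_inverse: "d > 0 \<Longrightarrow> (1 - fps_X ^ d) * geom d = 1"
  by (rule fps_ext)
     (auto simp: algebra_simps fps_X_power_mult_nth geom_def dvd_diff_nat dest: dvd_diffD nat_dvd_not_less)

lemma geom_shift: "d > 0 \<Longrightarrow> fps_X ^ d * geom d = geom d - 1"
  using geom_inverse[of d] by (simp add: algebra_simps)

lemma log_deriv_one_minus:
  assumes "d > 0" shows "log_deriv (1 - fps_X ^ d) (- of_nat d * (geom d - 1))"
proof -
  have "qderiv (1 - fps_X ^ d) = - of_nat d * fps_X ^ d"
    by (rule fps_ext) (auto simp: qderiv_nth fps_of_nat[symmetric])
  also have "\<dots> = - of_nat d * fps_X ^ d * ((1 - fps_X ^ d) * geom d)"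
    using assms by (simp add: geom_inverse)
  also have "\<dots> = (1 - fps_X ^ d) * (- of_nat d * (fps_X ^ d * geom d))"
    by (simp only: mult_ac)
  finally show ?thesis
    using assms by (simp add: log_deriv_def geom_shift)
qed

lemma log_deriv_geom:
  assumes "d > 0" shows "log_deriv (geom d) (of_nat d * (geom d - 1))"
proof -
  have "geom d * (1 - fps_X ^ d) = 1" and "1 - fps_X ^ d \<noteq> (0 :: int fps)"
    using geom_inverse[OF assms] by (auto simp: mult.commute)
  from log_deriv_cancel[OF this(1) log_deriv_one_minus[OF assms] log_deriv_1 this(2)]
  show ?thesis by simp
qed

text \<open>For k > 0 this is the k-th factor (1 - q^(2k)) / (1 - q^(2k-1)) of Gauss's product;
  \<open>geom\<close> supplies the inverse of the denominator.\<close>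

definition gauss_factor :: "nat \<Rightarrow> int fps" where
  "gauss_factor k = (1 - fps_X ^ (2 * k)) * geom (2 * k - 1)"

lemma gauss_factor_mult:
  "k > 0 \<Longrightarrow> (1 - fps_X ^ (2 * k - 1)) * gauss_factor k = 1 - fps_X ^ (2 * k)"
  using geom_inverse[of "2 * k - 1"] by (simp add: gauss_factor_def mult.left_commute)

definition gauss_tail :: "nat \<Rightarrow> nat \<Rightarrow> int fps" where
  "gauss_tail s n = (\<Prod>k\<in>{s<..n}. gauss_factor k)"

text \<open>The factor 1 - q^(2m+1) is the denominator of \<open>gauss_factor (Suc m)\<close>, so it
  turns \<open>gauss_tail m n\<close> into 1 - q^(2m+2) times \<open>gauss_tail (Suc m) n\<close>.
  Hence each summand is a difference of consecutive right-hand sides. The case m = n drives the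
  induction in \<open>gauss_finite\<close>.\<close>

lemma gauss_tail_telescope:
  "(\<Sum>s\<le>m. (fps_X ^ (s * (2 * n + 3)) * (1 - fps_X ^ (2 * n + 2))
      - fps_X ^ (s * (2 * n + 1)) * (1 - fps_X ^ (2 * n + 1))) * gauss_tail s n)
    = fps_X ^ ((m + 1) * (2 * n + 1)) * (1 - fps_X ^ (2 * m + 1)) * gauss_tail m n"
  if "m \<le> n"
  using that
proof (induction m)
  case 0
  then show ?case by (simp add: algebra_simps power_add[symmetric] gauss_tail_def power_mult power2_eq_square)
next
  case (Suc m)
  have "{m<..n} = insert (Suc m) {Suc m<..n}"
    using Suc.prems by auto
  then have "gauss_tail m n = gauss_factor (Suc m) * gauss_tail (Suc m) n"
    by (simp add: gauss_tail_def)
  then have "(1 - fps_X ^ (2 * m + 1)) * gauss_tail m n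
      = (1 - fps_X ^ (2 * Suc m)) * gauss_tail (Suc m) n"
    using gauss_factor_mult[of "Suc m"] by (simp add: mult.assoc[symmetric])
  then have IH: "(\<Sum>s\<le>m. (fps_X ^ (s * (2 * n + 3)) * (1 - fps_X ^ (2 * n + 2))
      - fps_X ^ (s * (2 * n + 1)) * (1 - fps_X ^ (2 * n + 1))) * gauss_tail s n)
      = fps_X ^ (Suc m * (2 * n + 1)) * ((1 - fps_X ^ (2 * Suc m)) * gauss_tail (Suc m) n)"
    using Suc by (simp only: mult.assoc Suc_eq_plus1)
  \<comment> \<open>With the powers split, the goal becomes a polynomial identity in q,
    q^((m+1)(2n+1)), q^(2m+2), q^(2n+1) and the tail.\<close>
  have pow: "fps_X ^ (Suc m * (2 * n + 3)) = fps_X ^ (Suc m * (2 * n + 1)) * fps_X ^ (2 * Suc m)"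
    "fps_X ^ ((Suc m + 1) * (2 * n + 1)) = fps_X ^ (Suc m * (2 * n + 1)) * fps_X ^ (2 * n + 1)"
    "fps_X ^ (2 * n + 2) = fps_X * fps_X ^ (2 * n + 1)"
    "fps_X ^ (2 * Suc m + 1) = fps_X * fps_X ^ (2 * Suc m)" for fps_X :: "int fps"
    by (simp_all only: power_add[symmetric] power_Suc[symmetric])
       (rule arg_cong[where f = "power fps_X"], simp add: algebra_simps)+
  show ?case
    unfolding sum.atMost_Suc IH unfolding pow by algebra
qed

text \<open>
  Shanks' finite form of Gauss's product: modulo q^(2n+1) only the summand s = 0 on the left
  survives, so a partial product agrees with the series of triangular numbers.
\<close>

lemma gauss_finite:
  "(\<Sum>s\<le>n. fps_X ^ (s * (2 * n + 1)) * gauss_tail s n)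
    = (\<Sum>i\<le>2 * n. fps_X ^ (i * (i + 1) div 2))"
proof (induction n)
  case 0
  then show ?case by (simp add: gauss_tail_def)
next
  case (Suc n)
  let ?u = "1 - fps_X ^ (2 * n + 1) :: int fps"
  \<comment> \<open>\<open>?u\<close> is the denominator of \<open>gauss_factor (Suc n)\<close>;
    multiplying by it compares products ending at n + 1 with those ending at n.\<close>
  have step: "?u * gauss_tail s (Suc n) = (1 - fps_X ^ (2 * n + 2)) * gauss_tail s n" if "s \<le> n" for s
  proof -
    have "{s<..Suc n} = insert (Suc n) {s<..n}"
      using that by auto
    then have "gauss_tail s (Suc n) = gauss_factor (Suc n) * gauss_tail s n"
      by (simp add: gauss_tail_def)
    then show ?thesis
      using gauss_factor_mult[of "Suc n"] by (simp add: mult.assoc[symmetric])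
  qed
  have "?u * (\<Sum>s\<le>n. fps_X ^ (s * (2 * n + 3)) * gauss_tail s (Suc n))
      - ?u * (\<Sum>s\<le>n. fps_X ^ (s * (2 * n + 1)) * gauss_tail s n)
      = (\<Sum>s\<le>n. fps_X ^ (s * (2 * n + 3)) * (?u * gauss_tail s (Suc n))
        - fps_X ^ (s * (2 * n + 1)) * ?u * gauss_tail s n)"
    by (simp add: sum_distrib_left sum_subtractf mult_ac)
  also have "\<dots> = (\<Sum>s\<le>n. (fps_X ^ (s * (2 * n + 3)) * (1 - fps_X ^ (2 * n + 2))
      - fps_X ^ (s * (2 * n + 1)) * ?u) * gauss_tail s n)"
  proof (intro sum.cong refl)
    fix s assume "s \<in> {..n}"
    then have "?u * gauss_tail s (Suc n) = (1 - fps_X ^ (2 * n + 2)) * gauss_tail s n"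
      by (intro step) simp
    show "fps_X ^ (s * (2 * n + 3)) * (?u * gauss_tail s (Suc n))
        - fps_X ^ (s * (2 * n + 1)) * ?u * gauss_tail s n
      = (fps_X ^ (s * (2 * n + 3)) * (1 - fps_X ^ (2 * n + 2))
        - fps_X ^ (s * (2 * n + 1)) * ?u) * gauss_tail s n"
      unfolding \<open>?u * gauss_tail s (Suc n) = _\<close>
      by (simp only: left_diff_distrib mult.assoc)
  qed
  also have "\<dots> = ?u * fps_X ^ ((n + 1) * (2 * n + 1))"
    by (subst gauss_tail_telescope) (simp_all add: gauss_tail_def mult.commute)
  finally have "?u * ((\<Sum>s\<le>n. fps_X ^ (s * (2 * n + 3)) * gauss_tail s (Suc n))
      - (\<Sum>s\<le>n. fps_X ^ (s * (2 * n + 1)) * gauss_tail s n) - fps_X ^ ((n + 1) * (2 * n + 1))) = 0"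
    by (simp only: right_diff_distrib) simp
  moreover have "?u \<noteq> 0"
  proof
    assume "?u = 0"
    then have "?u $ 0 = 0" by simp
    then show False by simp
  qed
  ultimately have "(\<Sum>s\<le>n. fps_X ^ (s * (2 * n + 3)) * gauss_tail s (Suc n))
      = (\<Sum>i\<le>2 * n. fps_X ^ (i * (i + 1) div 2)) + fps_X ^ ((n + 1) * (2 * n + 1))"
    unfolding Suc mult_eq_0_iff diff_diff_eq right_minus_eq by blast
  \<comment> \<open>The new exponents on the right: i = 2n + 1 gives the remainder of the
    telescoping sum, and i = 2n + 2 the new summand s = n + 1, whose tail is empty.\<close>
  moreover have "(2 * n + 1) * (2 * n + 1 + 1) div 2 = (n + 1) * (2 * n + 1)"
  proof -
    have "(2 * n + 1) * (2 * n + 1 + 1) = 2 * ((n + 1) * (2 * n + 1))" by (simp add: algebra_simps)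
    then show ?thesis by simp
  qed
  moreover have "(2 * n + 2) * (2 * n + 2 + 1) div 2 = (n + 1) * (2 * n + 3)"
  proof -
    have "(2 * n + 2) * (2 * n + 2 + 1) = 2 * ((n + 1) * (2 * n + 3))" by (simp add: algebra_simps)
    then show ?thesis by simp
  qed
  moreover have "2 * Suc n = Suc (Suc (2 * n))" by simp
  ultimately show ?case
    by (simp add: gauss_tail_def eval_nat_numeral)
qed

subsection \<open>Theta series\<close>

definition gen :: "'a set \<Rightarrow> ('a \<Rightarrow> int) \<Rightarrow> ('a \<Rightarrow> nat) \<Rightarrow> int fps" where
  "gen S w f = Abs_fps (\<lambda>n. \<Sum>x | x \<in> S \<and> f x = n. w x)"

text \<open>Sums over infinite sets are 0 by convention, so \<open>gen\<close> is a true formal sum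
  only under this condition.\<close>

definition finite_fibres :: "'a set \<Rightarrow> ('a \<Rightarrow> nat) \<Rightarrow> bool" where
  "finite_fibres S f \<longleftrightarrow> (\<forall>n. finite {x \<in> S. f x = n})"

lemma gen_nth: "gen S w f $ n = (\<Sum>x | x \<in> S \<and> f x = n. w x)"
  by (simp add: gen_def)

lemma finite_fibres_le:
  assumes "finite_fibres S f" shows "finite {x \<in> S. f x \<le> n}"
proof -
  have "{x \<in> S. f x \<le> n} = (\<Union>m\<le>n. {x \<in> S. f x = m})" by auto
  with assms show ?thesis by (simp add: finite_fibres_def)
qed

lemma finite_fibres_bound:
  assumes "finite_fibres S f" and "\<And>x. x \<in> T \<Longrightarrow> x \<in> S \<and> f x \<le> g x"
  shows "finite_fibres T g"
  unfolding finite_fibres_def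
proof
  fix n
  show "finite {x \<in> T. g x = n}"
    by (rule finite_subset[OF _ finite_fibres_le[OF assms(1), of n]]) (use assms(2) in auto)
qed

lemma finite_fibres_Times:
  assumes "finite_fibres S f" and "finite_fibres T g"
  shows "finite_fibres (S \<times> T) (\<lambda>(x, y). f x + g y)"
  unfolding finite_fibres_def
proof
  fix n
  show "finite {x \<in> S \<times> T. (case x of (x, y) \<Rightarrow> f x + g y) = n}"
    by (rule finite_subset[of _ "{x \<in> S. f x \<le> n} \<times> {y \<in> T. g y \<le> n}"])
       (auto intro: finite_fibres_le assms)
qed

lemma finite_fibres_int_square: "finite_fibres UNIV (\<lambda>i::int. nat (i ^ 2))"
  unfolding finite_fibres_def
proof
  fix n
  show "finite {x \<in> UNIV. nat (x ^ 2) = n}"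
  proof (rule finite_subset)
    show "{x \<in> UNIV. nat (x ^ 2) = n} \<subseteq> {- int n..int n}"
    proof
      fix x :: int assume "x \<in> {x \<in> UNIV. nat (x ^ 2) = n}"
      then have "x ^ 2 = int n" by auto
      moreover have "\<bar>x\<bar> \<le> x ^ 2"
        using self_le_power[of "\<bar>x\<bar>" 2] by (cases "x = 0") auto
      ultimately show "x \<in> {- int n..int n}" by auto
    qed
  qed simp
qed

lemma gen_mult:
  assumes "finite_fibres S f" and "finite_fibres T g"
  shows "gen S w f * gen T v g = gen (S \<times> T) (\<lambda>(x, y). w x * v y) (\<lambda>(x, y). f x + g y)"
proof (rule fps_ext)
  fix n
  let ?A = "\<lambda>i. {x \<in> S. f x = i}" and ?B = "\<lambda>i. {y \<in> T. g y = i}"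
  have fin: "finite (?A i)" "finite (?B i)" for i
    using assms by (auto simp: finite_fibres_def)
  have "(gen S w f * gen T v g) $ n = (\<Sum>i=0..n. \<Sum>(x, y)\<in>?A i \<times> ?B (n - i). w x * v y)"
    by (simp add: fps_mult_nth gen_nth sum_product sum.cartesian_product)
  also have "\<dots> = (\<Sum>(x, y)\<in>(\<Union>i\<in>{0..n}. ?A i \<times> ?B (n - i)). w x * v y)"
    by (rule sum.UNION_disjoint[symmetric]) (use fin in auto)
  also have "(\<Union>i\<in>{0..n}. ?A i \<times> ?B (n - i)) = {z \<in> S \<times> T. (case z of (x, y) \<Rightarrow> f x + g y) = n}"
    by auto
  finally show "(gen S w f * gen T v g) $ n
      = gen (S \<times> T) (\<lambda>(x, y). w x * v y) (\<lambda>(x, y). f x + g y) $ n"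
    by (simp add: gen_nth)
qed

lemma gen_compose_square: "gen S w f oo fps_X ^ 2 = gen S w (\<lambda>x. 2 * f x)"
  by (rule fps_ext) (auto simp: compose_square_nth gen_nth intro!: sum.cong sum.neutral)

lemma gen_bij:
  assumes "\<And>x. x \<in> S \<Longrightarrow> j x \<in> T \<and> i (j x) = x \<and> v (j x) = w x \<and> g (j x) = f x"
    and "\<And>y. y \<in> T \<Longrightarrow> i y \<in> S \<and> j (i y) = y"
  shows "gen S w f = gen T v g"
  by (rule fps_ext, simp add: gen_nth, rule sum.reindex_bij_witness[where i = i and j = j])
     (use assms in \<open>auto; metis\<close>)+

lemma gen_cong: "(\<And>x. x \<in> S \<Longrightarrow> w x = v x) \<Longrightarrow> gen S w f = gen S v f"
  by (simp add: gen_def cong: conj_cong)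

lemma gen_split:
  assumes "finite_fibres S f"
  shows "gen S w f = gen {x \<in> S. P x} w f + gen {x \<in> S. \<not> P x} w f"
proof (rule fps_ext)
  fix n
  have "{x \<in> S. f x = n} = {x. (x \<in> S \<and> P x) \<and> f x = n} \<union> {x. (x \<in> S \<and> \<not> P x) \<and> f x = n}"
    by auto
  moreover have "finite {x. (x \<in> S \<and> P x) \<and> f x = n}" "finite {x. (x \<in> S \<and> \<not> P x) \<and> f x = n}"
    by (rule finite_subset[of _ "{x \<in> S. f x = n}"]; use assms in \<open>auto simp: finite_fibres_def\<close>)+
  ultimately show "gen S w f $ n = (gen {x \<in> S. P x} w f + gen {x \<in> S. \<not> P x} w f) $ n"
    by (simp add: gen_nth sum.union_disjoint disjoint_iff)
qed

lemma gen_scale: "gen S (\<lambda>x. c * w x) f = of_int c * gen S w f"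
  by (rule fps_ext) (simp add: gen_nth sum_distrib_left fps_of_int[symmetric])

section \<open>Triangular numbers and the relations between theta and psi\<close>

definition triangular :: "int \<Rightarrow> nat" where
  "triangular i = nat (i * (i + 1) div 2)"

lemma double_triangular: "2 * int (triangular i) = i * (i + 1)"
proof -
  have "0 \<le> i * (i + 1)"
    by (cases "i \<ge> 0") (auto simp: zero_le_mult_iff)
  moreover have "even (i * (i + 1))" by simp
  ultimately show ?thesis
    by (simp add: triangular_def)
qed

lemma triangular_of_nat: "triangular (int i) = i * (i + 1) div 2"
  unfolding triangular_def by (metis nat_int of_nat_1 of_nat_add of_nat_mult of_nat_numeral zdiv_int)

text \<open>This reflection is the reason for indexing by all integers: each triangular number is
  then hit twice, and linear changes of variables become available.\<close>

lemma triangular_minus: "triangular (- 1 - i) = triangular i"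
  unfolding triangular_def by (rule arg_cong[of _ _ "\<lambda>x. nat (x div 2)"]) algebra

lemma finite_fibres_triangular: "finite_fibres UNIV triangular"
  unfolding finite_fibres_def
proof
  fix n
  show "finite {x \<in> UNIV. triangular x = n}"
  proof (rule finite_subset)
    show "{x \<in> UNIV. triangular x = n} \<subseteq> {- (2 * int n + 1)..2 * int n + 1}"
    proof
      fix x assume "x \<in> {x \<in> UNIV. triangular x = n}"
      then have eq: "x * (x + 1) = 2 * int n" using double_triangular[of x] by auto
      show "x \<in> {- (2 * int n + 1)..2 * int n + 1}"
      proof (cases "x \<ge> 0")
        case True
        then have "x * 1 \<le> x * (x + 1)" by (intro mult_left_mono) auto
        with eq True show ?thesis by auto
      next
        case False
        then have "(- x - 1) * 1 \<le> (- x - 1) * (- x)" by (intro mult_left_mono) auto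
        moreover have "(- x - 1) * (- x) = x * (x + 1)" by algebra
        ultimately show ?thesis using eq False by auto
      qed
    qed
  qed simp
qed

definition theta :: "int fps" where
  "theta = gen UNIV (\<lambda>_. 1) (\<lambda>i::int. nat (i ^ 2))"

definition psi :: "int fps" where
  "psi = gen {0..} (\<lambda>_. 1) triangular"

lemma two_psi: "gen UNIV (\<lambda>_. 1) triangular = 2 * psi"
proof -
  have "gen UNIV (\<lambda>_. 1) triangular = gen {x \<in> UNIV. 0 \<le> x} (\<lambda>_. 1) triangular
      + gen {x \<in> UNIV. \<not> 0 \<le> x} (\<lambda>_. 1) triangular"
    by (rule gen_split[OF finite_fibres_triangular])
  also have "gen {x \<in> UNIV. \<not> 0 \<le> x} (\<lambda>_. 1) triangular = gen {0..} (\<lambda>_. 1) triangular"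
    by (rule gen_bij[where i = "\<lambda>x. - 1 - x" and j = "\<lambda>x. - 1 - x"]) (auto simp: triangular_minus)
  finally show ?thesis by (simp add: psi_def atLeast_def)
qed

lemma half_sum: "even (i + j) \<Longrightarrow> (i + j) div 2 + (i - j) div 2 = i" for i j :: int
  by presburger

lemma half_diff: "even (i + j) \<Longrightarrow> (i + j) div 2 - (i - j) div 2 = j" for i j :: int
  by presburger

text \<open>Put i = u + v and j = u - v, so that T(i) + T(j) = v^2 + 2 T(u). This covers the pairs
  with i + j even; the reflection j to -1 - j maps the others onto them, so that both halves are
  equal.\<close>

lemma psi_square: "psi ^ 2 = theta * (psi oo fps_X ^ 2)"
proof -
  let ?t = "\<lambda>(i, j). triangular i + triangular j"
    and ?s = "\<lambda>(v, u). nat (v ^ 2) + 2 * triangular u"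
  have fin: "finite_fibres (UNIV \<times> UNIV) ?t"
    by (intro finite_fibres_Times finite_fibres_triangular)
  have par: "triangular (u + v) + triangular (u - v) = nat (v ^ 2) + 2 * triangular u" for u v
  proof -
    have "2 * int (triangular (u + v) + triangular (u - v)) = 2 * int (nat (v ^ 2) + 2 * triangular u)"
      using double_triangular[of "u + v"] double_triangular[of "u - v"] double_triangular[of u]
      by (simp add: algebra_simps power2_eq_square)
    then show ?thesis unfolding mult_cancel_left of_nat_eq_iff by simp
  qed
  have "(2 * psi) * (2 * psi) = gen (UNIV \<times> UNIV) (\<lambda>_. 1) ?t"
    by (simp flip: two_psi add: gen_mult finite_fibres_triangular case_prod_unfold)
  also have "\<dots> = gen {x \<in> UNIV \<times> UNIV. even (fst x + snd x)} (\<lambda>_. 1) ?t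
      + gen {x \<in> UNIV \<times> UNIV. \<not> even (fst x + snd x)} (\<lambda>_. 1) ?t"
    by (rule gen_split[OF fin])
  also have "gen {x \<in> UNIV \<times> UNIV. \<not> even (fst x + snd x)} (\<lambda>_. 1) ?t
      = gen {x \<in> UNIV \<times> UNIV. even (fst x + snd x)} (\<lambda>_. 1) ?t"
    by (rule gen_bij[where i = "\<lambda>(x, y). (x, - 1 - y)" and j = "\<lambda>(x, y). (x, - 1 - y)"])
       (auto simp: triangular_minus)
  also have "gen {x \<in> UNIV \<times> UNIV. even (fst x + snd x)} (\<lambda>_. 1) ?t
      = gen (UNIV \<times> UNIV) (\<lambda>_. 1) ?s"
    by (rule gen_bij[where j = "\<lambda>(i, j). ((i - j) div 2, (i + j) div 2)" and i = "\<lambda>(v, u). (u + v, u - v)"])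
       (auto simp: half_sum half_diff par[symmetric])
  also have "\<dots> = theta * (gen UNIV (\<lambda>_. 1) triangular oo fps_X ^ 2)"
    unfolding theta_def gen_compose_square
    by (subst gen_mult)
       (auto simp: finite_fibres_int_square case_prod_unfold
          intro: finite_fibres_bound[OF finite_fibres_triangular])
  also have "\<dots> = theta * (2 * (psi oo fps_X ^ 2))"
    by (simp add: two_psi fps_compose_mult_distrib)
  finally show ?thesis
    by (simp add: power2_eq_square)
qed

lemma gen_shift: "fps_X * gen S w f = gen S w (\<lambda>x. Suc (f x))"
proof (rule fps_ext)
  show "(fps_X * gen S w f) $ n = gen S w (\<lambda>x. Suc (f x)) $ n" for n
    by (cases n) (auto simp: gen_nth)
qed

text \<open>Pairs with even sum are (u + v, u - v), with squares adding up to 2u^2 + 2v^2. Pairs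
  with odd sum are (u + v + 1, u - v), with squares adding up to 1 + 4T(u) + 4T(v). The factor 4
  arises because summing over all integers counts psi twice in each variable.\<close>

lemma theta_square:
  "theta ^ 2 = (theta oo fps_X ^ 2) ^ 2 + 4 * fps_X * ((psi oo fps_X ^ 2) oo fps_X ^ 2) ^ 2"
proof -
  let ?q = "\<lambda>(i::int, j::int). nat (i ^ 2) + nat (j ^ 2)"
    and ?e = "\<lambda>(u::int, v::int). 2 * nat (u ^ 2) + 2 * nat (v ^ 2)"
    and ?o = "\<lambda>(u, v). 2 * (2 * triangular u) + 2 * (2 * triangular v)"
  have fin: "finite_fibres (UNIV \<times> UNIV) ?q"
    by (intro finite_fibres_Times finite_fibres_int_square)
  have even_par: "nat ((u + v) ^ 2) + nat ((u - v) ^ 2) = 2 * nat (u ^ 2) + 2 * nat (v ^ 2)" for u v :: int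
  proof -
    have "int (nat ((u + v) ^ 2) + nat ((u - v) ^ 2)) = int (2 * nat (u ^ 2) + 2 * nat (v ^ 2))"
      by simp (simp add: power2_eq_square algebra_simps)
    then show ?thesis unfolding of_nat_eq_iff .
  qed
  have odd_par: "nat ((u + v + 1) ^ 2) + nat ((u - v) ^ 2)
      = Suc (2 * (2 * triangular u) + 2 * (2 * triangular v))" for u v
  proof -
    have "int (nat ((u + v + 1) ^ 2) + nat ((u - v) ^ 2))
        = int (Suc (2 * (2 * triangular u) + 2 * (2 * triangular v)))"
      using double_triangular[of u] double_triangular[of v]
      by simp (simp add: power2_eq_square algebra_simps)
    then show ?thesis unfolding of_nat_eq_iff .
  qed
  have "theta ^ 2 = gen (UNIV \<times> UNIV) (\<lambda>_. 1) ?q"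
    by (simp add: theta_def power2_eq_square[of "gen _ _ _"] gen_mult finite_fibres_int_square case_prod_unfold)
  also have "\<dots> = gen {x \<in> UNIV \<times> UNIV. even (fst x + snd x)} (\<lambda>_. 1) ?q
      + gen {x \<in> UNIV \<times> UNIV. \<not> even (fst x + snd x)} (\<lambda>_. 1) ?q"
    by (rule gen_split[OF fin])
  also have "gen {x \<in> UNIV \<times> UNIV. even (fst x + snd x)} (\<lambda>_. 1) ?q = gen (UNIV \<times> UNIV) (\<lambda>_. 1) ?e"
    by (rule gen_bij[where j = "\<lambda>(i, j). ((i + j) div 2, (i - j) div 2)" and i = "\<lambda>(u, v). (u + v, u - v)"])
       (auto simp: half_sum half_diff even_par[symmetric])
  also have "\<dots> = (theta oo fps_X ^ 2) ^ 2"
    unfolding theta_def gen_compose_square power2_eq_square[of "gen _ _ _"]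
    by (subst gen_mult)
       (auto simp: case_prod_unfold intro: finite_fibres_bound[OF finite_fibres_int_square])
  also have "gen {x \<in> UNIV \<times> UNIV. \<not> even (fst x + snd x)} (\<lambda>_. 1) ?q
      = gen (UNIV \<times> UNIV) (\<lambda>_. 1) (\<lambda>x. Suc (?o x))"
  proof (rule gen_bij[where j = "\<lambda>(i, j). ((i + j - 1) div 2, (i - j - 1) div 2)"
        and i = "\<lambda>(u, v). (u + v + 1, u - v)"], goal_cases)
    case (1 z)
    obtain i j where z: "z = (i, j)" by (cases z)
    define u v where "u = (i + j - 1) div 2" and "v = (i - j - 1) div 2"
    have "odd (i + j)" using 1 z by simp
    then have "i = u + v + 1" "j = u - v" unfolding u_def v_def by presburger+
    with z show ?case
      unfolding z prod.case u_def[symmetric] v_def[symmetric] by (simp add: odd_par)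
  qed auto
  also have "\<dots> = fps_X * (gen UNIV (\<lambda>_. 1) triangular oo fps_X ^ 2 oo fps_X ^ 2) ^ 2"
    unfolding gen_compose_square gen_shift[symmetric] power2_eq_square[of "gen _ _ _"]
    by (subst gen_mult)
       (auto simp: case_prod_unfold intro: finite_fibres_bound[OF finite_fibres_triangular])
  also have "\<dots> = fps_X * (2 * (psi oo fps_X ^ 2 oo fps_X ^ 2)) ^ 2"
    by (simp add: two_psi fps_compose_mult_distrib)
  finally show ?thesis
    by (simp add: power_mult_distrib mult_ac)
qed

section \<open>Divisor sums and the logarithmic derivative of psi\<close>

definition pairs :: "(nat \<times> nat) set" where
  "pairs = {(d, x). d > 0 \<and> x > 0}"

text \<open>The sign reflects Gauss's product: odd d come from its denominators, even d from its
  numerators.\<close>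

definition alt_divisors :: "int fps" where
  "alt_divisors = gen pairs (\<lambda>(d, x). (- 1) ^ (d + 1) * int d) (\<lambda>(d, x). d * x)"

lemma finite_fibres_pairs: "finite_fibres pairs (\<lambda>(d, x). d * x)"
  unfolding finite_fibres_def
proof
  fix n
  show "finite {z \<in> pairs. (case z of (d, x) \<Rightarrow> d * x) = n}"
    by (rule finite_subset[of _ "{..n} \<times> {..n}"]) (auto simp: pairs_def)
qed

lemma gen_pairs_nth:
  assumes "n > 0"
  shows "gen {z \<in> pairs. P z} w (\<lambda>(d, x). d * x) $ n
    = (\<Sum>d | d dvd n \<and> P (d, n div d). w (d, n div d))"
  unfolding gen_nth
  by (rule sum.reindex_bij_witness[where j = fst and i = "\<lambda>d. (d, n div d)"])
     (use assms in \<open>auto simp: pairs_def elim!: dvdE\<close>)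

lemma psi_nth_gauss:
  assumes "m \<le> 2 * n" shows "psi $ m = gauss_tail 0 n $ m"
proof -
  have "(\<Sum>s\<le>n. fps_X ^ (s * (2 * n + 1)) * gauss_tail s n) $ m
      = (\<Sum>s\<le>n. if s = 0 then gauss_tail 0 n $ m else 0)"
    unfolding fps_sum_nth
  proof (intro sum.cong refl)
    fix s
    have "m < s * (2 * n + 1)" if "s > 0"
      using mult_le_mono1[of 1 s "2 * n + 1"] that assms by simp
    then show "(fps_X ^ (s * (2 * n + 1)) * gauss_tail s n) $ m = (if s = 0 then gauss_tail 0 n $ m else 0)"
      by (simp add: fps_X_power_mult_nth)
  qed
  also have "\<dots> = gauss_tail 0 n $ m" by simp
  finally have "gauss_tail 0 n $ m = (\<Sum>i\<le>2 * n. if i * (i + 1) div 2 = m then 1 else 0)"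
    unfolding gauss_finite fps_sum_nth by (simp add: eq_commute)
  also have "\<dots> = (\<Sum>i | i \<le> 2 * n \<and> i * (i + 1) div 2 = m. 1)"
    by (subst sum.inter_filter[symmetric]) auto
  also have "\<dots> = psi $ m"
    unfolding psi_def gen_nth
  proof (rule sum.reindex_bij_witness[where i = nat and j = int])
    fix i assume i: "i \<in> {i. i \<le> 2 * n \<and> i * (i + 1) div 2 = m}"
    then show "int i \<in> {x. x \<in> {0..} \<and> triangular x = m}"
      by (simp add: triangular_of_nat)
  next
    fix x assume x: "x \<in> {x. x \<in> {0..} \<and> triangular x = m}"
    then have "2 * int m = x * (x + 1)" using double_triangular[of x] by auto
    \<comment> \<open>This yields x \<le> m, so the finite range up to 2n misses no triangular
      number equal to m.\<close>
    moreover have "x * 2 \<le> x * (x + 1)"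
      using x by (cases "x = 0") (auto intro!: mult_left_mono)
    ultimately have "nat x \<le> 2 * n" using assms by linarith
    moreover have "nat x * (nat x + 1) div 2 = m"
      using x triangular_of_nat[of "nat x"] by simp
    ultimately show "nat x \<in> {i. i \<le> 2 * n \<and> i * (i + 1) div 2 = m}" by simp
  qed auto
  finally show ?thesis by simp
qed

lemma log_deriv_prod:
  "finite A \<Longrightarrow> (\<And>k. k \<in> A \<Longrightarrow> log_deriv (f k) (l k))
    \<Longrightarrow> log_deriv (\<Prod>k\<in>A. f k) (\<Sum>k\<in>A. l k)"
  by (induction A rule: finite_induct) (auto intro: log_deriv_1 log_deriv_mult)

lemma sum_pairs_of_consecutive:
  "(\<Sum>k\<in>{0<..n}. g (2 * k) + g (2 * k - 1)) = (\<Sum>d\<in>{0<..2 * n}. g d)" for g :: "nat \<Rightarrow> int"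
proof (induction n)
  case (Suc n)
  have "{0<..Suc n} = insert (Suc n) {0<..n}"
    "{0<..2 * Suc n} = insert (2 * Suc n) (insert (2 * Suc n - 1) {0<..2 * n})"
    by auto
  with Suc show ?case by simp
qed simp

text \<open>Coefficient m of either side involves only coefficients up to m. There psi agrees with
  the partial product of m factors, and these contain every d \<le> 2m, hence all divisors that
  occur.\<close>

lemma log_deriv_psi: "log_deriv psi alt_divisors"
  unfolding log_deriv_def
proof (rule fps_ext)
  fix m
  define L where "L = (\<Sum>k\<in>{0<..m}. - of_nat (2 * k) * (geom (2 * k) - 1)
      + of_nat (2 * k - 1) * (geom (2 * k - 1) - 1))"
  have "log_deriv (gauss_tail 0 m) L"
    unfolding gauss_tail_def gauss_factor_def L_def
    by (intro log_deriv_prod log_deriv_mult log_deriv_one_minus log_deriv_geom) auto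
  moreover have "alt_divisors $ i = L $ i" if "i \<le> m" for i
  proof (cases "i = 0")
    case True
    then show ?thesis
      by (simp add: alt_divisors_def gen_nth pairs_def L_def fps_sum_nth geom_def case_prod_unfold)
         (rule sum.neutral, auto)
  next
    case False
    let ?g = "\<lambda>d. if d dvd i then (- 1) ^ (d + 1) * int d else 0"
    have "L $ i = (\<Sum>k\<in>{0<..m}. ?g (2 * k) + ?g (2 * k - 1))"
      unfolding L_def fps_sum_nth
      by (intro sum.cong refl)
         (use False in \<open>auto simp: geom_def fps_of_nat[symmetric] simp del: of_nat_mult of_nat_diff\<close>)
    also have "\<dots> = (\<Sum>d\<in>{0<..2 * m}. ?g d)"
      by (rule sum_pairs_of_consecutive)
    also have "\<dots> = (\<Sum>d | d \<in> {0<..2 * m} \<and> d dvd i. (- 1) ^ (d + 1) * int d)"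
      by (subst sum.inter_filter[symmetric]) auto
    also have "{d. d \<in> {0<..2 * m} \<and> d dvd i} = {d. d dvd i}"
      using False that by (auto dest: dvd_imp_le intro!: Nat.gr0I)
    finally show ?thesis
      using gen_pairs_nth[of i "\<lambda>_. True"] False by (simp add: alt_divisors_def)
  qed
  ultimately have "int m * gauss_tail 0 m $ m = (\<Sum>i=0..m. gauss_tail 0 m $ i * alt_divisors $ (m - i))"
    unfolding log_deriv_def qderiv_nth[symmetric] by (simp add: fps_mult_nth)
  then show "qderiv psi $ m = (psi * alt_divisors) $ m"
    by (simp add: qderiv_nth fps_mult_nth psi_nth_gauss[where n = m])
qed

subsection \<open>Liouville's identity\<close>

text \<open>The index set of coefficient n in the product of a divisor series at q^2 with the series
  of sigma over odd numbers: x is even because of q^2, while b and y are odd divisors and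
  cofactors.\<close>

definition liouville_set :: "nat \<Rightarrow> (nat \<times> nat \<times> nat \<times> nat) set" where
  "liouville_set n = {(a, b, x, y). a > 0 \<and> b > 0 \<and> x > 0 \<and> y > 0 \<and> a * x + b * y = n
     \<and> odd b \<and> even x \<and> odd y}"

text \<open>Common target of the two regroupings, with l in the role of a + b or of |a - b|.\<close>

definition level_set :: "nat \<Rightarrow> (nat \<times> nat \<times> nat \<times> nat) set" where
  "level_set n = {(l, b, x, y). l > 0 \<and> b > 0 \<and> x > 0 \<and> y > 0 \<and> l * x + b * y = n \<and> odd y}"

lemma quadruple_bounds:
  assumes "a > 0" "b > 0" "x > 0" "y > 0" "a * x + b * y = (n::nat)"
  shows "a \<le> n" "b \<le> n" "x \<le> n" "y \<le> n"
proof -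
  have "a \<le> a * x" "x \<le> a * x" "b \<le> b * y" "y \<le> b * y"
    using assms(1-4) by simp_all
  with assms(5) show "a \<le> n" "b \<le> n" "x \<le> n" "y \<le> n" by linarith+
qed

lemma finite_liouville_set: "finite (liouville_set n)"
proof (rule finite_subset)
  show "liouville_set n \<subseteq> {..n} \<times> {..n} \<times> {..n} \<times> {..n}"
  proof
    fix z assume "z \<in> liouville_set n"
    moreover obtain a b x y where "z = (a, b, x, y)" by (cases z)
    ultimately show "z \<in> {..n} \<times> {..n} \<times> {..n} \<times> {..n}"
      using quadruple_bounds[of a b x y n] by (simp add: liouville_set_def)
  qed
qed simp

lemma finite_level_set: "finite (level_set n)"
proof (rule finite_subset)
  show "level_set n \<subseteq> {..n} \<times> {..n} \<times> {..n} \<times> {..n}"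
  proof
    fix z assume "z \<in> level_set n"
    moreover obtain a b x y where "z = (a, b, x, y)" by (cases z)
    ultimately show "z \<in> {..n} \<times> {..n} \<times> {..n} \<times> {..n}"
      using quadruple_bounds[of a b x y n] by (simp add: level_set_def)
  qed
qed simp

lemma card_odd_below: "card {y. odd y \<and> y < m} = m div 2" for m :: nat
proof (induction m)
  case (Suc m)
  have "{y. odd y \<and> y < Suc m} = (if odd m then insert m {y. odd y \<and> y < m} else {y. odd y \<and> y < m})"
    by (auto simp: less_Suc_eq)
  with Suc show ?case by auto
qed simp

context
  fixes F :: "int \<Rightarrow> int" and n :: nat
  assumes even_F: "\<And>l. F (- l) = F l" and F_0: "F 0 = 0" and odd_n: "odd n"
begin

text \<open>
  Sorting the quadruples by l = a + b and by l = |a - b| turns a x + b y = n into an equation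
  l x' + b' y' = n with y' odd; the two resulting conditions, b' < l and x' < y', are exchanged up
  to diagonal terms by the substitution in \<open>sum_F_swap\<close>.
\<close>

lemma sum_F_plus:
  "(\<Sum>(a, b, x, y)\<in>liouville_set n. F (int a + int b))
    = (\<Sum>(l, b, x, y) | (l, b, x, y) \<in> level_set n \<and> b < l. F (int l))"
\<comment> \<open>a x + b y is (a + b) x + b (y - x) if x < y, and (a + b) y + a (x - y) otherwise.
  The new third entry is the even x or the odd y, so its parity tells the inverse map which case
  applies.\<close>
proof (rule sum.reindex_bij_witness[where
      j = "\<lambda>(a, b, x, y). if x < y then (a + b, b, x, y - x) else (a + b, a, y, x - y)" and
      i = "\<lambda>(l, b, x, y). if even x then (l - b, b, x, x + y) else (b, l - b, x + y, x)"], goal_cases)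
  case (1 z)
  obtain a b x y where z: "z = (a, b, x, y)" by (cases z)
  with 1 have mem: "a > 0" "b > 0" "x > 0" "y > 0" "odd b" "even x" "odd y"
    by (auto simp: liouville_set_def)
  then have "x < y \<or> y < x" by (metis nat_neq_iff)
  with z mem show ?case by auto
next
  case (2 z)
  obtain a b x y where z: "z = (a, b, x, y)" by (cases z)
  with 2 have mem: "a > 0" "b > 0" "x > 0" "y > 0" "a * x + b * y = n" "odd b" "even x" "odd y"
    by (auto simp: liouville_set_def)
  then consider k where "y = x + k" "k > 0" | k where "x = y + k" "k > 0"
    by (metis less_imp_add_positive nat_neq_iff)
  then show ?case
    using mem z by cases (auto simp: level_set_def algebra_simps)
next
  case (3 z)
  obtain l b x y where z: "z = (l, b, x, y)" by (cases z)
  with 3 have mem: "l > 0" "b > 0" "x > 0" "y > 0" "l * x + b * y = n" "odd y" "b < l"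
    by (auto simp: level_set_def)
  then show ?case using z by auto
next
  case (4 z)
  obtain l b x y where z: "z = (l, b, x, y)" by (cases z)
  with 4 have mem: "l > 0" "b > 0" "x > 0" "y > 0" "l * x + b * y = n" "odd y" "b < l"
    by (auto simp: level_set_def)
  moreover from mem obtain k where "l = b + k" "k > 0"
    by (metis less_imp_add_positive)
  \<comment> \<open>Here the oddness of n enters: it restores the parity of the second entry, which
    is b or l - b.\<close>
  moreover have "even x \<longrightarrow> odd b" and "odd x \<longrightarrow> odd l \<longleftrightarrow> even b"
    using mem odd_n by auto
  ultimately show ?case using z by (auto simp: liouville_set_def algebra_simps)
qed auto

text \<open>a x + b y is (a - b) x + b (x + y) if b < a, and (b - a) y + a (x + y) if a < b; again
  parity separates the cases. Quadruples with a = b contribute F 0 = 0, and evenness of F absorbs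
  the sign.\<close>

lemma sum_F_minus:
  "(\<Sum>(a, b, x, y)\<in>liouville_set n. F (int a - int b))
    = (\<Sum>(l, b, x, y) | (l, b, x, y) \<in> level_set n \<and> x < y. F (int l))"
proof -
  have "(\<Sum>(a, b, x, y)\<in>liouville_set n. F (int a - int b))
      = (\<Sum>(a, b, x, y) | (a, b, x, y) \<in> liouville_set n \<and> a \<noteq> b. F (int a - int b))"
    by (rule sum.mono_neutral_right) (auto simp: finite_liouville_set F_0)
  also have "\<dots> = (\<Sum>(l, b, x, y) | (l, b, x, y) \<in> level_set n \<and> x < y. F (int l))"
  proof (rule sum.reindex_bij_witness[where
        j = "\<lambda>(a, b, x, y). if b < a then (a - b, b, x, x + y) else (b - a, a, y, x + y)" and
        i = "\<lambda>(l, b, x, y). if even x then (l + b, b, x, y - x) else (b, l + b, y - x, x)"], goal_cases)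
    case (1 z)
    obtain a b x y where z: "z = (a, b, x, y)" by (cases z)
    with 1 have mem: "a > 0" "b > 0" "x > 0" "y > 0" "odd b" "even x" "odd y" "a \<noteq> b"
      by (auto simp: liouville_set_def)
    with z show ?case by auto
  next
    case (2 z)
    obtain a b x y where z: "z = (a, b, x, y)" by (cases z)
    with 2 have mem: "a > 0" "b > 0" "x > 0" "y > 0" "a * x + b * y = n" "odd b" "even x" "odd y" "a \<noteq> b"
      by (auto simp: liouville_set_def)
    then consider k where "a = b + k" "k > 0" | k where "b = a + k" "k > 0"
      by (metis less_imp_add_positive nat_neq_iff)
    then show ?case
      using mem z by cases (auto simp: level_set_def algebra_simps)
  next
    case (3 z)
    obtain l b x y where z: "z = (l, b, x, y)" by (cases z)
    with 3 have mem: "l > 0" "b > 0" "x > 0" "y > 0" "x < y"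
      by (auto simp: level_set_def)
    then show ?case using z by auto
  next
    case (4 z)
    obtain l b x y where z: "z = (l, b, x, y)" by (cases z)
    with 4 have mem: "l > 0" "b > 0" "x > 0" "y > 0" "l * x + b * y = n" "odd y" "x < y"
      by (auto simp: level_set_def)
    moreover from mem obtain k where "y = x + k" "k > 0"
      by (metis less_imp_add_positive)
    moreover have "even x \<longrightarrow> odd b" and "odd x \<longrightarrow> odd l \<longleftrightarrow> even b"
      using mem odd_n by auto
    ultimately show ?case using z by (auto simp: liouville_set_def algebra_simps)
  next
    case (5 z)
    obtain a b x y where z: "z = (a, b, x, y)" by (cases z)
    show ?case
      using even_F[of "int a - int b"] z by (auto simp: of_nat_diff)
  qed
  finally show ?thesis .
qed

text \<open>Rests on l x + b y = l (x + y) + (b - l) y, which keeps both the level l and the odd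
  y.\<close>

lemma sum_F_swap:
  "(\<Sum>(l, b, x, y) | (l, b, x, y) \<in> level_set n \<and> l < b. F (int l))
    = (\<Sum>(l, b, x, y) | (l, b, x, y) \<in> level_set n \<and> y < x. F (int l))"
proof (rule sum.reindex_bij_witness[where
      j = "\<lambda>(l, b, x, y). (l, b - l, x + y, y)" and
      i = "\<lambda>(l, b, x, y). (l, b + l, x - y, y)"], goal_cases)
  case (2 z)
  obtain l b x y where z: "z = (l, b, x, y)" by (cases z)
  with 2 obtain k where "b = l + k" "k > 0" by (auto dest: less_imp_add_positive)
  then show ?case using 2 z by (auto simp: level_set_def algebra_simps)
next
  case (4 z)
  obtain l b x y where z: "z = (l, b, x, y)" by (cases z)
  with 4 obtain k where "x = y + k" "k > 0" by (auto dest: less_imp_add_positive)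
  then show ?case using 4 z by (auto simp: level_set_def algebra_simps)
qed auto

text \<open>If x = y then (l + b) x = n, so d = l + b is a divisor and l ranges below it; the
  cofactor is odd since n is.\<close>

lemma sum_F_diagonal_right:
  "(\<Sum>(l, b, x, y) | (l, b, x, y) \<in> level_set n \<and> x = y. F (int l))
    = (\<Sum>d | d dvd n. \<Sum>l\<in>{0<..<d}. F (int l))"
proof -
  have "(\<Sum>(l, b, x, y) | (l, b, x, y) \<in> level_set n \<and> x = y. F (int l))
      = (\<Sum>(d, l)\<in>Sigma {d. d dvd n} (\<lambda>d. {0<..<d}). F (int l))"
  proof (rule sum.reindex_bij_witness[where
        j = "\<lambda>(l, b, x, y). (l + b, l)" and i = "\<lambda>(d, l). (l, d - l, n div d, n div d)"], goal_cases)
    case (1 z)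
    then show ?case by (auto simp: level_set_def add_mult_distrib[symmetric])
  next
    case (2 z)
    then show ?case by (auto simp: level_set_def add_mult_distrib[symmetric])
  next
    case (4 z)
    obtain d l where z: "z = (d, l)" by (cases z)
    with 4 have "d dvd n" "l < d" "0 < l" by auto
    moreover from this obtain e where e: "n = d * e" by blast
    moreover have "odd e" "e > 0" "n > 0" using odd_n e by (auto intro: Nat.gr0I)
    ultimately show ?case
      by (auto simp: z level_set_def add_mult_distrib[symmetric])
  qed auto
  also have "\<dots> = (\<Sum>d | d dvd n. \<Sum>l\<in>{0<..<d}. F (int l))"
    using odd_n by (subst sum.Sigma) (auto intro!: finite_divisors_nat Nat.gr0I)
  finally show ?thesis .
qed

text \<open>If l = b then l (x + y) = n, and the factor counts the odd y below n/l.\<close>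

lemma sum_F_diagonal_left:
  "(\<Sum>(l, b, x, y) | (l, b, x, y) \<in> level_set n \<and> l = b. F (int l))
    = (\<Sum>l | l dvd n. F (int l) * int (n div l div 2))"
proof -
  have "(\<Sum>(l, b, x, y) | (l, b, x, y) \<in> level_set n \<and> l = b. F (int l))
      = (\<Sum>(l, y)\<in>Sigma {l. l dvd n} (\<lambda>l. {y. odd y \<and> y < n div l}). F (int l))"
  proof (rule sum.reindex_bij_witness[where
        j = "\<lambda>(l, b, x, y). (l, y)" and i = "\<lambda>(l, y). (l, l, n div l - y, y)"], goal_cases)
    case (1 z)
    then show ?case by (auto simp: level_set_def add_mult_distrib2[symmetric])
  next
    case (2 z)
    then show ?case by (auto simp: level_set_def add_mult_distrib2[symmetric])
  next
    case (4 z)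
    obtain l y where z: "z = (l, y)" by (cases z)
    with 4 have "l dvd n" "y < n div l" "odd y" by auto
    moreover from this obtain e where e: "n = l * e" by blast
    moreover have "l > 0" "y > 0" using odd_n e \<open>odd y\<close> by (auto intro!: Nat.gr0I)
    ultimately show ?case
      by (auto simp: z level_set_def add_mult_distrib2[symmetric])
  qed auto
  also have "\<dots> = (\<Sum>l | l dvd n. F (int l) * int (n div l div 2))"
    using odd_n by (subst sum.Sigma[symmetric]) (auto intro!: finite_divisors_nat Nat.gr0I simp: card_odd_below mult.commute)
  finally show ?thesis .
qed

text \<open>\<open>level_set n\<close> is split by comparing b with l, and again by comparing x with
  y. Two of the parts are the sums for a + b and a - b, two cancel by \<open>sum_F_swap\<close>, and
  the diagonals remain.\<close>

lemma liouville:
  "(\<Sum>(a, b, x, y)\<in>liouville_set n. F (int a + int b) - F (int a - int b))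
    = (\<Sum>d | d dvd n. (\<Sum>l\<in>{0<..<d}. F (int l)) - F (int d) * int (n div d div 2))"
proof -
  have split: "(\<Sum>(l, b, x, y)\<in>level_set n. F (int l))
      = (\<Sum>(l, b, x, y) | (l, b, x, y) \<in> level_set n \<and> f l b x y < g l b x y. F (int l))
      + (\<Sum>(l, b, x, y) | (l, b, x, y) \<in> level_set n \<and> f l b x y = g l b x y. F (int l))
      + (\<Sum>(l, b, x, y) | (l, b, x, y) \<in> level_set n \<and> g l b x y < f l b x y. F (int l))"
    for f g :: "nat \<Rightarrow> nat \<Rightarrow> nat \<Rightarrow> nat \<Rightarrow> nat"
  proof -
    let ?S = "\<lambda>P. {z \<in> level_set n. case z of (l, b, x, y) \<Rightarrow> P l b x y}"
    have "(\<Sum>(l, b, x, y)\<in>level_set n. F (int l))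
        = (\<Sum>(l, b, x, y)\<in>?S (\<lambda>l b x y. f l b x y < g l b x y) \<union> ?S (\<lambda>l b x y. f l b x y = g l b x y)
          \<union> ?S (\<lambda>l b x y. g l b x y < f l b x y). F (int l))"
      by (rule sum.cong) auto
    also have "\<dots> = (\<Sum>(l, b, x, y)\<in>?S (\<lambda>l b x y. f l b x y < g l b x y). F (int l))
        + (\<Sum>(l, b, x, y)\<in>?S (\<lambda>l b x y. f l b x y = g l b x y). F (int l))
        + (\<Sum>(l, b, x, y)\<in>?S (\<lambda>l b x y. g l b x y < f l b x y). F (int l))"
      by (subst sum.union_disjoint; (subst sum.union_disjoint)?; auto simp: finite_level_set)
    finally show ?thesis
      by (simp add: case_prod_unfold)
  qed
  show ?thesis
    using split[of "\<lambda>l b x y. b" "\<lambda>l b x y. l"] split[of "\<lambda>l b x y. x" "\<lambda>l b x y. y"]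
      sum_F_plus sum_F_minus sum_F_swap sum_F_diagonal_left sum_F_diagonal_right
    by (simp add: sum_subtractf case_prod_unfold eq_commute)
qed

end

subsection \<open>Four and eight squares\<close>

lemma liouville_alternating:
  assumes "odd n"
  shows "8 * (\<Sum>(a, b, x, y)\<in>liouville_set n. (- 1) ^ (a + 1) * int a * int b)
    = (int n - 1) * (\<Sum>d | d dvd n. int d)"
proof -
  \<comment> \<open>F(l) = (-1)^l l^2. As b is odd, F(a + b) - F(a - b) = 4 (-1)^(a+1) a b.\<close>
  define F :: "int \<Rightarrow> int" where "F = (\<lambda>l. if even l then l ^ 2 else - (l ^ 2))"
  have F_sum: "2 * (\<Sum>l\<in>{0<..<d}. F (int l)) = (if odd d then int d * (int d - 1) else - (int d * (int d - 1)))"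
    if "d > 0" for d
    using that
  proof (induction d rule: nat_induct_non_zero)
    case (Suc d)
    then have "{0<..<Suc d} = insert d {0<..<d}" by auto
    with Suc show ?case by (auto simp: F_def power2_eq_square algebra_simps)
  qed simp
  have "2 * (4 * (\<Sum>(a, b, x, y)\<in>liouville_set n. (- 1) ^ (a + 1) * int a * int b))
      = 2 * (\<Sum>(a, b, x, y)\<in>liouville_set n. F (int a + int b) - F (int a - int b))"
    unfolding sum_distrib_left
    by (intro sum.cong refl) (auto simp: liouville_set_def F_def power2_eq_square algebra_simps)
  also have "\<dots> = (\<Sum>d | d dvd n. 2 * (\<Sum>l\<in>{0<..<d}. F (int l)) - F (int d) * (2 * int (n div d div 2)))"
    using assms by (subst liouville) (auto simp: F_def sum_distrib_left algebra_simps)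
  also have "\<dots> = (\<Sum>d | d dvd n. (int n - 1) * int d)"
  proof (intro sum.cong refl)
    fix d assume "d \<in> {d. d dvd n}"
    then obtain e where e: "n = d * e" by auto
    with assms have "odd d" "odd e" "d > 0" by (auto intro: Nat.gr0I)
    \<comment> \<open>The divisor d contributes d (d - 1) + d^2 (e - 1) = (n - 1) d.\<close>
    moreover have "2 * int (e div 2) = int e - 1" using \<open>odd e\<close> by presburger
    ultimately show "2 * (\<Sum>l\<in>{0<..<d}. F (int l)) - F (int d) * (2 * int (n div d div 2)) = (int n - 1) * int d"
      unfolding e by (simp add: F_sum) (simp add: F_def power2_eq_square algebra_simps)
  qed
  finally show ?thesis by (simp add: sum_distrib_left)
qed

lemma liouville_odd:
  assumes "odd n"
  shows "24 * (\<Sum>(a, b, x, y) | (a, b, x, y) \<in> liouville_set n \<and> odd a. int a * int b)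
    = (\<Sum>d | d dvd n. int d ^ 3 - int d)"
proof -
  \<comment> \<open>As b is odd, a + b and a - b are even exactly for odd a, and then the difference
    is 4 a b. Every divisor of n is odd, so the term F(d) on the right vanishes.\<close>
  define F :: "int \<Rightarrow> int" where "F = (\<lambda>l. if even l then l ^ 2 else 0)"
  have F_sum: "6 * (\<Sum>l\<in>{0<..<2 * k + 1}. F (int l)) = int (2 * k + 1) ^ 3 - int (2 * k + 1)" for k
  proof (induction k)
    case (Suc k)
    have "{0<..<2 * Suc k + 1} = insert (2 * k + 1) (insert (2 * k + 2) {0<..<2 * k + 1})" by auto
    with Suc show ?case by (simp add: F_def power2_eq_square power3_eq_cube algebra_simps)
  qed simp
  have "6 * (4 * (\<Sum>(a, b, x, y) | (a, b, x, y) \<in> liouville_set n \<and> odd a. int a * int b))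
      = 6 * (\<Sum>(a, b, x, y) | (a, b, x, y) \<in> liouville_set n \<and> odd a. F (int a + int b) - F (int a - int b))"
    unfolding sum_distrib_left
    by (intro sum.cong refl) (auto simp: liouville_set_def F_def power2_eq_square algebra_simps)
  also have "(\<Sum>(a, b, x, y) | (a, b, x, y) \<in> liouville_set n \<and> odd a. F (int a + int b) - F (int a - int b))
      = (\<Sum>(a, b, x, y)\<in>liouville_set n. F (int a + int b) - F (int a - int b))"
    by (rule sum.mono_neutral_left[OF finite_liouville_set]) (auto simp: liouville_set_def F_def)
  also have "6 * \<dots> = (\<Sum>d | d dvd n. 6 * (\<Sum>l\<in>{0<..<d}. F (int l)) - 6 * F (int d) * int (n div d div 2))"
    using assms by (subst liouville) (auto simp: F_def sum_distrib_left algebra_simps)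
  also have "\<dots> = (\<Sum>d | d dvd n. int d ^ 3 - int d)"
  proof (intro sum.cong refl)
    fix d assume "d \<in> {d. d dvd n}"
    with assms have "odd d" by auto
    then obtain k where "d = 2 * k + 1" by (auto elim: oddE)
    then show "6 * (\<Sum>l\<in>{0<..<d}. F (int l)) - 6 * F (int d) * int (n div d div 2) = int d ^ 3 - int d"
      using F_sum[of k] by (simp add: F_def)
  qed
  finally show ?thesis by linarith
qed

section \<open>Divisor series and the fourth power of psi\<close>

definition odd_sigma :: "int fps" where
  "odd_sigma = gen {(d, x) \<in> pairs. odd d \<and> odd x} (\<lambda>(d, x). int d) (\<lambda>(d, x). d * x)"

text \<open>Sums the odd divisors of every positive n, whereas \<open>odd_sigma\<close> sums all
  divisors of odd n only.\<close>

definition sigma_odd :: "int fps" where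
  "sigma_odd = gen {(d, x) \<in> pairs. odd d} (\<lambda>(d, x). int d) (\<lambda>(d, x). d * x)"

lemma odd_sigma_nth: "odd_sigma $ n = (if odd n then \<Sum>d | d dvd n. int d else 0)"
proof (cases "odd n")
  case True
  then have "n > 0" by (auto intro: Nat.gr0I)
  moreover have "odd d \<and> odd (n div d)" if "d dvd n" for d
    using True dvd_mult_div_cancel[OF that] by (metis even_mult_iff)
  then have "{d. d dvd n \<and> odd d \<and> odd (n div d)} = {d. d dvd n}"
    by auto
  ultimately show ?thesis
    using True gen_pairs_nth[of n "\<lambda>(d, x). odd d \<and> odd x"]
    by (simp add: odd_sigma_def case_prod_unfold)
next
  case False
  then show ?thesis
    by (auto simp: odd_sigma_def gen_nth intro!: sum.neutral)
qed

lemma sigma_odd_nth: "n > 0 \<Longrightarrow> sigma_odd $ n = (\<Sum>d | d dvd n \<and> odd d. int d)"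
  using gen_pairs_nth[of n "\<lambda>(d, x). odd d"]
  by (simp add: sigma_odd_def case_prod_unfold)

lemma sigma_odd_nth_double:
  assumes "n > 0" shows "sigma_odd $ (2 * n) = sigma_odd $ n"
proof -
  have "{d. d dvd 2 * n \<and> odd d} = {d. d dvd n \<and> odd d}"
    by (auto simp: coprime_dvd_mult_right_iff)
  with assms show ?thesis by (simp add: sigma_odd_nth)
qed

lemma sigma_odd_nth_odd:
  assumes "odd n" shows "sigma_odd $ n = odd_sigma $ n"
proof -
  have "{d. d dvd n \<and> odd d} = {d. d dvd n}"
    using assms dvd_trans[of 2 _ n] by blast
  moreover have "n > 0"
    using assms by (auto intro: Nat.gr0I)
  ultimately show ?thesis
    using assms by (simp add: sigma_odd_nth odd_sigma_nth)
qed

lemma gen_compose_square_mult_odd_sigma_nth: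
  assumes "odd n" and "S = {z \<in> pairs. P (fst z)}"
  shows "((gen S (\<lambda>(d, x). w d) (\<lambda>(d, x). d * x) oo fps_X ^ 2) * odd_sigma) $ n
    = (\<Sum>(a, b, x, y) | (a, b, x, y) \<in> liouville_set n \<and> P a. w a * int b)"
proof -
  let ?S = "S \<times> {(d, x) \<in> pairs. odd d \<and> odd x}"
  have fin: "finite_fibres S (\<lambda>z. 2 * (case z of (d, x) \<Rightarrow> d * x))"
    "finite_fibres {(d, x) \<in> pairs. odd d \<and> odd x} (\<lambda>(d, x). d * x)"
    by (auto intro!: finite_fibres_bound[OF finite_fibres_pairs] simp: assms(2))
  have "((gen S (\<lambda>(d, x). w d) (\<lambda>(d, x). d * x) oo fps_X ^ 2) * odd_sigma) $ n
      = (\<Sum>((a, x), (b, y)) | ((a, x), (b, y)) \<in> ?S \<and> 2 * (a * x) + b * y = n. w a * int b)"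
    unfolding odd_sigma_def gen_compose_square gen_mult[OF fin] gen_nth
    by (rule sum.cong) auto
  also have "\<dots> = (\<Sum>(a, b, x, y) | (a, b, x, y) \<in> liouville_set n \<and> P a. w a * int b)"
  proof (rule sum.reindex_bij_witness[where j = "\<lambda>((a, x), (b, y)). (a, b, 2 * x, y)"
        and i = "\<lambda>(a, b, x, y). ((a, x div 2), (b, y))"], goal_cases)
    case (2 z)
    then show ?case by (auto simp: assms(2) pairs_def liouville_set_def)
  next
    case (3 z)
    then show ?case by (auto simp: liouville_set_def)
  next
    case (4 z)
    obtain a b x y where z: "z = (a, b, x, y)" by (cases z)
    with 4 have "even x" by (auto simp: liouville_set_def)
    then obtain k where "x = 2 * k" by blast
    with 4 z show ?case by (auto simp: assms(2) pairs_def liouville_set_def)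
  qed auto
  finally show ?thesis .
qed

lemma compose_square_mult_odd_sigma_even:
  assumes "even n" shows "((f oo fps_X ^ 2) * odd_sigma) $ n = 0"
  unfolding fps_mult_nth
proof (rule sum.neutral, rule ballI)
  fix i assume "i \<in> {0..n}"
  then show "(f oo fps_X ^ 2) $ i * odd_sigma $ (n - i) = 0"
    using assms by (auto simp: compose_square_nth odd_sigma_nth)
qed

lemma numeral_mult_nth: "(numeral k * f) $ n = numeral k * f $ n" for f :: "int fps"
  by (simp add: numeral_fps_const)

text \<open>At odd n this is \<open>liouville_alternating\<close>, with n - 1 accounting for the
  summand 1; at even n both sides vanish.\<close>

lemma log_deriv_odd_sigma: "log_deriv odd_sigma (1 + 8 * (alt_divisors oo fps_X ^ 2))"
  unfolding log_deriv_def
proof (rule fps_ext)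
  fix n
  have *: "(odd_sigma * (1 + 8 * (alt_divisors oo fps_X ^ 2))) $ n
      = odd_sigma $ n + 8 * ((alt_divisors oo fps_X ^ 2) * odd_sigma) $ n"
    by (simp add: distrib_left mult.left_commute[of _ 8] numeral_mult_nth mult.commute[of odd_sigma])
  show "qderiv odd_sigma $ n = (odd_sigma * (1 + 8 * (alt_divisors oo fps_X ^ 2))) $ n"
  proof (cases "odd n")
    case True
    have "((alt_divisors oo fps_X ^ 2) * odd_sigma) $ n
        = (\<Sum>(a, b, x, y)\<in>liouville_set n. (- 1) ^ (a + 1) * int a * int b)"
      using gen_compose_square_mult_odd_sigma_nth[OF True, of pairs "\<lambda>_. True"]
      by (simp add: alt_divisors_def)
    with liouville_alternating[OF True] True show ?thesis
      unfolding * by (simp add: qderiv_nth odd_sigma_nth algebra_simps)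
  next
    case False
    then show ?thesis
      unfolding * by (simp add: qderiv_nth odd_sigma_nth compose_square_mult_odd_sigma_even)
  qed
qed

lemma psi_nth_0: "psi $ 0 = 1"
  using psi_nth_gauss[of 0 0] by (simp add: gauss_tail_def)

lemma alt_divisors_nth_0: "alt_divisors $ 0 = 0"
  by (auto simp: alt_divisors_def gen_nth pairs_def intro!: sum.neutral)

text \<open>Both series have logarithmic derivative 1 + 8 \<open>alt_divisors\<close>(q^2); the
  constant term 1 is the order of vanishing, so it suffices to compare coefficients 0 and 1.\<close>

lemma odd_sigma_eq: "odd_sigma = fps_X * (psi oo fps_X ^ 2) ^ 4"
proof (rule log_deriv_unique[where k = 1])
  show "log_deriv odd_sigma (of_nat 1 + 8 * (alt_divisors oo fps_X ^ 2))"
    using log_deriv_odd_sigma by simp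
  have "log_deriv fps_X 1"
    by (simp add: log_deriv_def qderiv_def)
  from log_deriv_mult[OF this log_deriv_power[OF log_deriv_compose_square[OF log_deriv_psi], of 4]]
  show "log_deriv (fps_X * (psi oo fps_X ^ 2) ^ 4) (of_nat 1 + 8 * (alt_divisors oo fps_X ^ 2))"
    by (simp add: mult.assoc[symmetric])
  show "(8 * (alt_divisors oo fps_X ^ 2)) $ 0 = 0"
    by (simp add: compose_square_nth alt_divisors_nth_0)
  fix n :: nat assume "n \<le> 1"
  then consider "n = 0" | "n = 1" by linarith
  then show "odd_sigma $ n = (fps_X * (psi oo fps_X ^ 2) ^ 4) $ n"
    by cases (simp_all add: odd_sigma_nth fps_nth_power_0 compose_square_nth psi_nth_0)
qed

section \<open>Jacobi's four-square theorem, and the eight-square theorem at odd arguments\<close>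

lemma theta_power_4:
  "theta ^ 4 = (theta ^ 4 oo fps_X ^ 2) + 16 * (odd_sigma oo fps_X ^ 2) + 8 * odd_sigma"
proof -
  define t p p' where "t = theta oo fps_X ^ 2" and "p = psi oo fps_X ^ 2" and "p' = p oo fps_X ^ 2"
  have "psi ^ 2 oo fps_X ^ 2 = (theta * p) oo fps_X ^ 2"
    by (simp add: psi_square p_def)
  \<comment> \<open>\<open>psi_square\<close> at q^2; it turns the cross term of the square below
    into 8 q psi(q^2)^4.\<close>
  then have p: "p ^ 2 = t * p'"
    by (simp add: p_def p'_def t_def fps_compose_mult_distrib fps_compose_power)
  have "theta ^ 4 = (t ^ 2 + 4 * fps_X * p' ^ 2) ^ 2"
    unfolding t_def p'_def p_def theta_square[symmetric] by simp
  also have "\<dots> = t ^ 4 + 16 * (fps_X ^ 2 * p' ^ 4) + 8 * (fps_X * (t * p') ^ 2)"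
    by algebra
  also have "(t * p') ^ 2 = p ^ 4"
    by (simp add: p[symmetric])
  also have "fps_X * p ^ 4 = odd_sigma"
    by (simp add: odd_sigma_eq p_def)
  also have "t ^ 4 = theta ^ 4 oo fps_X ^ 2"
    by (simp add: t_def fps_compose_power)
  also have "fps_X ^ 2 * p' ^ 4 = odd_sigma oo fps_X ^ 2"
    by (simp add: odd_sigma_eq p_def p'_def fps_compose_mult_distrib fps_compose_power)
  finally show ?thesis .
qed

lemma theta_nth_0: "theta $ 0 = 1"
  by (simp add: theta_def gen_nth)

text \<open>Descent by halving: the coefficient at 2n exceeds that at n by 16 sigma(n) for odd n,
  giving 8 + 16 = 24, and equals it for even n.\<close>

lemma theta_power_4_nth_even: "n > 0 \<Longrightarrow> theta ^ 4 $ (2 * n) = 24 * sigma_odd $ n"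
proof (induction n rule: less_induct)
  case (less n)
  have rec: "theta ^ 4 $ (2 * n) = theta ^ 4 $ n + 16 * odd_sigma $ n" for n
    by (subst theta_power_4) (simp add: numeral_mult_nth compose_square_nth odd_sigma_nth[of "2 * _"])
  show ?case
  proof (cases "odd n")
    case True
    have "theta ^ 4 $ n = 8 * odd_sigma $ n"
      by (subst theta_power_4) (simp add: True numeral_mult_nth compose_square_nth)
    with True show ?thesis unfolding rec by (simp add: sigma_odd_nth_odd)
  next
    case False
    then obtain m where m: "n = 2 * m" by auto
    with less have "theta ^ 4 $ n = 24 * sigma_odd $ m" by simp
    with less.prems m show ?thesis unfolding rec
      by (simp add: odd_sigma_nth sigma_odd_nth_double)
  qed
qed

lemma theta_power_4_eq: "theta ^ 4 = ((1 + 24 * sigma_odd) oo fps_X ^ 2) + 8 * odd_sigma"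
proof (rule fps_ext)
  fix n
  show "theta ^ 4 $ n = (((1 + 24 * sigma_odd) oo fps_X ^ 2) + 8 * odd_sigma) $ n"
  proof (cases "odd n")
    case True
    then show ?thesis
      by (subst theta_power_4) (simp add: numeral_mult_nth compose_square_nth)
  next
    case False
    then obtain m where m: "n = 2 * m" by auto
    show ?thesis
    proof (cases "m = 0")
      case True
      have "sigma_odd $ 0 = 0"
        by (auto simp: sigma_odd_def gen_nth pairs_def intro!: sum.neutral)
      with True m show ?thesis
        by (simp add: fps_nth_power_0 theta_nth_0 compose_square_nth odd_sigma_nth numeral_mult_nth)
    next
      case False
      with m show ?thesis
        by (simp add: theta_power_4_nth_even compose_square_nth odd_sigma_nth numeral_mult_nth)
    qed
  qed
qed

lemma theta_power_4_nth_odd: "odd n \<Longrightarrow> theta ^ 4 $ n = 8 * (\<Sum>d | d dvd n. int d)"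
  by (simp add: theta_power_4_eq compose_square_nth numeral_mult_nth odd_sigma_nth)

text \<open>In the square of \<open>theta_power_4_eq\<close> only the cross term has odd exponents.
  Its coefficient is 16 times sigma(n) plus the sum of d^3 - d from \<open>liouville_odd\<close>, so
  the linear terms cancel.\<close>

lemma theta_power_8_nth_odd:
  assumes "odd n" shows "theta ^ 8 $ n = 16 * (\<Sum>d | d dvd n. int d ^ 3)"
proof -
  let ?e = "(1 + 24 * sigma_odd) oo fps_X ^ 2"
  have "theta ^ 8 = (theta ^ 4) ^ 2"
    by (simp flip: power_mult)
  also have "\<dots> = ?e ^ 2 + 64 * odd_sigma ^ 2 + 16 * (?e * odd_sigma)"
    unfolding theta_power_4_eq by algebra
  finally have "theta ^ 8 $ n = ?e ^ 2 $ n + 64 * odd_sigma ^ 2 $ n + 16 * (?e * odd_sigma) $ n"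
    by (simp add: numeral_mult_nth)
  moreover have "?e ^ 2 $ n = 0"
    using assms by (simp add: fps_compose_power compose_square_nth)
  moreover have "odd_sigma ^ 2 $ n = 0"
    unfolding power2_eq_square fps_mult_nth
    by (rule sum.neutral) (use assms in \<open>auto simp: odd_sigma_nth\<close>)
  moreover have "(?e * odd_sigma) $ n = odd_sigma $ n + 24 * ((sigma_odd oo fps_X ^ 2) * odd_sigma) $ n"
    by (simp add: fps_compose_add_distrib fps_compose_mult_distrib distrib_right mult.assoc numeral_mult_nth)
  moreover have "((sigma_odd oo fps_X ^ 2) * odd_sigma) $ n
      = (\<Sum>(a, b, x, y) | (a, b, x, y) \<in> liouville_set n \<and> odd a. int a * int b)"
    unfolding sigma_odd_def by (rule gen_compose_square_mult_odd_sigma_nth[OF assms]) auto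
  ultimately show ?thesis
    using liouville_odd[OF assms] assms by (simp add: odd_sigma_nth sum_subtractf)
qed

section \<open>The function sigma* and the recurrence for r_k\<close>

definition sigma_star_series :: "int fps" where
  "sigma_star_series = gen {(d, x) \<in> pairs. odd x} (\<lambda>(d, x). int d) (\<lambda>(d, x). d * x)"

lemma sigma_star_series_nth: "n > 0 \<Longrightarrow> sigma_star_series $ n = sigma_star (of_nat n)"
  using gen_pairs_nth[of n "\<lambda>(d, x). odd x"]
  by (simp add: sigma_star_series_def case_prod_unfold sigma_star_of_nat)

text \<open>Let V substitute q^2 for q and let S be the series of sigma. Then
  \<open>alt_divisors\<close> = (1 - 4V) S and \<open>sigma_star_series\<close> = (1 - V) S, and the
  two operators commute.\<close>

lemma alt_divisors_sigma_star:
  "alt_divisors - (alt_divisors oo fps_X ^ 2) = sigma_star_series - 4 * (sigma_star_series oo fps_X ^ 2)"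
proof -
  let ?f = "\<lambda>(d::nat, x). d * x" and ?w = "\<lambda>(d, x::nat). int d"
  define sig where "sig = gen pairs ?w ?f"
  have "sig = gen {z \<in> pairs. odd (snd z)} ?w ?f + gen {z \<in> pairs. \<not> odd (snd z)} ?w ?f"
    unfolding sig_def by (rule gen_split[OF finite_fibres_pairs])
  also have "gen {z \<in> pairs. \<not> odd (snd z)} ?w ?f = gen pairs ?w (\<lambda>z. 2 * ?f z)"
    by (rule gen_bij[where j = "\<lambda>(d, x). (d, x div 2)" and i = "\<lambda>(d, x). (d, 2 * x)"])
       (auto simp: pairs_def elim!: evenE)
  also have "\<dots> = sig oo fps_X ^ 2"
    unfolding sig_def gen_compose_square ..
  also have "{z \<in> pairs. odd (snd z)} = {(d, x) \<in> pairs. odd x}"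
    by auto
  finally have "sig = sigma_star_series + (sig oo fps_X ^ 2)"
    unfolding sigma_star_series_def .
  then have star: "sigma_star_series = sig - (sig oo fps_X ^ 2)"
    by (simp add: algebra_simps)
  have even: "gen {z \<in> pairs. \<not> odd (fst z)} ?w ?f = 2 * (sig oo fps_X ^ 2)"
  proof -
    have "gen {z \<in> pairs. \<not> odd (fst z)} ?w ?f = gen pairs (\<lambda>z. 2 * ?w z) (\<lambda>z. 2 * ?f z)"
      by (rule gen_bij[where j = "\<lambda>(d, x). (d div 2, x)" and i = "\<lambda>(d, x). (2 * d, x)"])
         (auto simp: pairs_def elim!: evenE)
    then show ?thesis
      by (simp add: gen_scale sig_def gen_compose_square)
  qed
  have "alt_divisors = gen {z \<in> pairs. odd (fst z)} ?w ?f + gen {z \<in> pairs. \<not> odd (fst z)} (\<lambda>z. (- 1) * ?w z) ?f"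
    unfolding alt_divisors_def
    by (subst gen_split[OF finite_fibres_pairs, of _ "\<lambda>z. odd (fst z)"], rule arg_cong2[of _ _ _ _ plus])
       (auto intro!: gen_cong)
  also have "gen {z \<in> pairs. odd (fst z)} ?w ?f = sig - 2 * (sig oo fps_X ^ 2)"
    unfolding eq_diff_eq even[symmetric] unfolding sig_def
    by (rule gen_split[OF finite_fibres_pairs, symmetric])
  also have "gen {z \<in> pairs. \<not> odd (fst z)} (\<lambda>z. (- 1) * ?w z) ?f = - 2 * (sig oo fps_X ^ 2)"
    unfolding gen_scale even by simp
  finally have alt: "alt_divisors = sig - 4 * (sig oo fps_X ^ 2)"
    by simp
  show ?thesis
    unfolding star alt
    by (simp add: fps_compose_sub_distrib fps_compose_mult_distrib algebra_simps)
qed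

lemma sigma_star_half_nth:
  assumes "n > 0"
  shows "(sigma_star_series oo fps_X ^ 2) $ n = sigma_star (of_nat n / 2)"
proof (cases "even n")
  case True
  with assms show ?thesis
    by (auto simp: compose_square_nth sigma_star_series_nth elim!: evenE)
next
  case False
  have "(of_nat n / 2 :: rat) \<notin> \<nat>"
  proof
    assume "(of_nat n / 2 :: rat) \<in> \<nat>"
    then obtain m where "(of_nat n / 2 :: rat) = of_nat m" by (auto elim: Nats_cases)
    then have "(of_nat n :: rat) = of_nat (2 * m)" by simp
    then have "n = 2 * m" unfolding of_nat_eq_iff .
    with False show False by simp
  qed
  with False show ?thesis by (simp add: compose_square_nth sigma_star_def)
qed

lemma log_deriv_theta:
  "log_deriv theta (2 * (sigma_star_series - 4 * (sigma_star_series oo fps_X ^ 2)))"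
proof -
  have "psi oo fps_X ^ 2 \<noteq> 0"
    using psi_nth_0 by (auto simp: fps_eq_iff compose_square_nth intro!: exI[of _ 0])
  from log_deriv_cancel[OF psi_square[symmetric] log_deriv_compose_square[OF log_deriv_psi]
      log_deriv_power[OF log_deriv_psi] this]
  show ?thesis
    by (simp add: alt_divisors_sigma_star[symmetric] right_diff_distrib)
qed

lemma theta_power_nth: "theta ^ k $ n = int (r k n)"
proof -
  let ?q = "\<lambda>xs::int list. nat (\<Sum>x\<leftarrow>xs. x ^ 2)"
  have nonneg: "0 \<le> (\<Sum>x\<leftarrow>xs. x ^ 2)" for xs :: "int list"
    by (intro sum_list_nonneg) auto
  then have fibre: "?q xs = n \<longleftrightarrow> (\<Sum>x\<leftarrow>xs. x ^ 2) = int n" for xs n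
    by (metis int_nat_eq nat_int)
  have "theta ^ k = gen {xs. length xs = k} (\<lambda>_. 1) ?q"
  proof (induction k)
    case 0
    show ?case by (rule fps_ext) (auto simp: gen_nth cong: conj_cong)
  next
    case (Suc k)
    have "finite_fibres {xs. length xs = k} ?q"
      unfolding finite_fibres_def fibre using finite_representations by simp
    then have "theta ^ Suc k = gen (UNIV \<times> {xs. length xs = k}) (\<lambda>_. 1) (\<lambda>(x, xs). nat (x ^ 2) + ?q xs)"
      unfolding power_Suc Suc.IH unfolding theta_def
      by (subst gen_mult) (simp_all add: finite_fibres_int_square case_prod_unfold)
    also have "\<dots> = gen {xs. length xs = Suc k} (\<lambda>_. 1) ?q"
      by (rule gen_bij[where j = "\<lambda>(x, xs). x # xs" and i = "\<lambda>xs. (hd xs, tl xs)"])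
         (auto simp: nat_add_distrib nonneg length_Suc_conv)
    finally show ?case .
  qed
  then show ?thesis
    by (simp add: gen_nth fibre r_def)
qed

text \<open>Coefficient n of q d/dq applied to theta^k, where the logarithmic derivative of theta is
  multiplied by k.\<close>

lemma representation_recurrence:
  assumes "n > 0"
  shows "int n * int (r k n) = 2 * int k * (sigma_star (of_nat n) - 4 * sigma_star (of_nat n / 2)
    + (\<Sum>j = 1..n - 1. int (r k j) *
        (sigma_star (of_nat n - of_nat j) - 4 * sigma_star ((of_nat n - of_nat j) / 2))))"
proof -
  let ?s = "\<lambda>m. sigma_star (of_nat m) - 4 * sigma_star (of_nat m / 2)"
  define D where "D = sigma_star_series - 4 * (sigma_star_series oo fps_X ^ 2)"
  have D: "D $ m = ?s m" for m
  proof (cases "m = 0")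
    case True
    then show ?thesis
      by (auto simp: D_def compose_square_nth numeral_mult_nth sigma_star_series_def gen_nth pairs_def
          sigma_star_def intro!: sum.neutral)
  qed (simp add: D_def numeral_mult_nth sigma_star_series_nth sigma_star_half_nth)
  have "qderiv (theta ^ k) = of_nat (2 * k) * (theta ^ k * D)"
    using log_deriv_power[OF log_deriv_theta, of k] by (simp add: log_deriv_def D_def mult_ac)
  then have "int n * theta ^ k $ n = 2 * int k * (theta ^ k * D) $ n"
    unfolding qderiv_nth[symmetric] by (simp flip: fps_of_nat of_nat_mult)
  also have "(theta ^ k * D) $ n = (\<Sum>j=0..n. theta ^ k $ j * ?s (n - j))"
    by (simp add: fps_mult_nth D)
  \<comment> \<open>The term j = 0 has \<open>theta ^ k $ 0 = 1\<close> and gives the isolated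
    values at n; the term j = n vanishes since \<open>sigma_star 0 = 0\<close>.\<close>
  also have "{0..n} = insert 0 (insert n {1..n - 1})"
    using assms by auto
  also have "(\<Sum>j\<in>\<dots>. theta ^ k $ j * ?s (n - j)) = ?s n + (\<Sum>j = 1..n - 1. theta ^ k $ j * ?s (n - j))"
    using assms by (simp add: fps_nth_power_0 theta_nth_0 sigma_star_def)
  also have "(\<Sum>j = 1..n - 1. theta ^ k $ j * ?s (n - j))
      = (\<Sum>j = 1..n - 1. theta ^ k $ j *
          (sigma_star (of_nat n - of_nat j) - 4 * sigma_star ((of_nat n - of_nat j) / 2)))"
    by (intro sum.cong refl) (auto simp: of_nat_diff)
  finally show ?thesis
    by (simp only: theta_power_nth)
qed

theorem theorem3p5:
  fixes p :: nat
  assumes "prime p" and "odd p"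
  shows "(\<Sum>j = 1..p - 1. int (r 4 j) *
            (sigma_star (of_nat p - of_nat j) - 4 * sigma_star ((of_nat p - of_nat j) / 2)))
          = int p ^ 2 - 1
       \<and> (\<Sum>j = 1..p - 1. int (r 8 j) *
            (sigma_star (of_nat p - of_nat j) - 4 * sigma_star ((of_nat p - of_nat j) / 2)))
          = int p ^ 4 - 1"
proof -
  have "d = 1 \<or> d = p" if "d dvd p" for d
    using \<open>prime p\<close> that unfolding prime_nat_iff by blast
  then have p: "p > 1" "{d. d dvd p} = {1, p}"
    using prime_gt_1_nat[OF \<open>prime p\<close>] by auto
  have "{d. d dvd p \<and> odd (p div d)} = {d \<in> {d. d dvd p}. odd (p div d)}"
    by simp
  also have "\<dots> = {1, p}"
    unfolding p(2) using p(1) \<open>odd p\<close> by auto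
  finally have "{d. d dvd p \<and> odd (p div d)} = {1, p}" .
  then have "sigma_star (of_nat p) = int p + 1"
    using p by (simp add: sigma_star_of_nat)
  moreover have "sigma_star (of_nat p / 2) = 0"
    using sigma_star_half_nth[of p] p \<open>odd p\<close> by (simp add: compose_square_nth)
  ultimately have rec: "int p * int (r k p) = 2 * int k * (int p + 1
      + (\<Sum>j = 1..p - 1. int (r k j) *
          (sigma_star (of_nat p - of_nat j) - 4 * sigma_star ((of_nat p - of_nat j) / 2))))" for k
    using representation_recurrence[of p k] p(1) by simp
  have r: "int (r 4 p) = 8 * (int p + 1)" "int (r 8 p) = 16 * (int p ^ 3 + 1)"
    using theta_power_4_nth_odd[OF \<open>odd p\<close>] theta_power_8_nth_odd[OF \<open>odd p\<close>] p
    by (simp_all add: theta_power_nth)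
  \<comment> \<open>Cancelling 8 or 16 leaves p (p + 1) = p + 1 + s or p (p^3 + 1) = p + 1 +
    s.\<close>
  have "s = int p ^ 2 - 1" if "int p * (8 * (int p + 1)) = 2 * int 4 * (int p + 1 + s)" for s
    using that by (simp add: algebra_simps power2_eq_square)
  moreover have "s = int p ^ 4 - 1" if "int p * (16 * (int p ^ 3 + 1)) = 2 * int 8 * (int p + 1 + s)" for s
    using that by (simp add: algebra_simps power3_eq_cube power4_eq_xxxx)
  ultimately show ?thesis
    using rec[of 4] rec[of 8] unfolding r by blast
qed

end
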